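(* There is a constant $C\ge 2$ such that the following holds for all $a>0$ and all $R>Ca$. For every $(\mathbf{x}^\circ,\mathbf{y}^\circ),(\mathbf{x}^f,\mathbf{y}^f)\in\mathcal{S}_R^{1+1}$ there exist $T>0$ and a control $\mathbf{u}\in L^\infty([0,T];\mathbb{R}^3)$ such that the system $$\begin{cases}\dot{\mathbf{x}}(t)=\mathbf{u}(t),\\[1mm] \displaystyle\dot{\mathbf{y}}(t)=\frac{3a}{4}\left(\frac{1}{|\mathbf{d}(t)|}\mathbb{I}+\frac{1}{|\mathbf{d}(t)|^3}\,\mathbf{d}(t)\otimes\mathbf{d}(t)\right)\mathbf{u}(t),\end{cases}\qquad \mathbf{d}(t)=\mathbf{y}(t)-\mathbf{x}(t),$$ admits a unique solution $(\mathbf{x},\mathbf{y})\in AC([0,T];\mathcal{S}_R^{1+1})$ with $(\mathbf{x}(0),\mathbf{y}(0))=(\mathbf{x}^\circ,\mathbf{y}^\circ)$, and this solution satisfies $(\mathbf{x}(T),\mathbf{y}(T))=(\mathbf{x}^f,\mathbf{y}^f)$.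
   Context: Here $\mathbf{x}(t),\mathbf{y}(t)\in\mathbb{R}^3$ are the positions of one active (controlled) and one passive spherical particle, both of radius $a>0$. $\mathbb{I}$ is the $3\times 3$ identity matrix and $\mathbf{d}\otimes\mathbf{d}=\mathbf{d}\mathbf{d}^\top$. For $R>0$, $$\mathcal{S}_R^{1+1}=\{(\mathbf{x},\mathbf{y})\in\mathbb{R}^3\times\mathbb{R}^3:\ |\mathbf{x}-\mathbf{y}|>R\}$$ is the set of well-separated configurations. $AC([0,T];\mathcal{S}_R^{1+1})$ is the set of absolutely continuous curves $[0,T]\to\mathbb{R}^6$ taking values in $\mathcal{S}_R^{1+1}$ for all $t\in[0,T]$; the differential equation is required to hold for almost every $t\in[0,T]$. *)

theory Defs
  imports "HOL-Analysis.Analysis"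
begin

(* The epsilon-delta definition. The members of a division are the closed intervals
   {Inf K..Sup K} of a finite family with pairwise disjoint interiors; they are not
   required to cover S. *)
definition absolutely_continuous_on :: "real set \<Rightarrow> (real \<Rightarrow> 'a::metric_space) \<Rightarrow> bool" where
  "absolutely_continuous_on S f \<longleftrightarrow>
     (\<forall>\<epsilon>>0. \<exists>\<delta>>0. \<forall>D. D division_of \<Union>D \<and> \<Union>D \<subseteq> S \<and> (\<Sum>K\<in>D. Sup K - Inf K) < \<delta> \<longrightarrow>
        (\<Sum>K\<in>D. dist (f (Inf K)) (f (Sup K))) < \<epsilon>)"

(* Functions rather than classes modulo equality almost everywhere; values outside S are irrelevant. *)
definition L_infinity :: "real set \<Rightarrow> (real \<Rightarrow> 'a::euclidean_space) set" where
  "L_infinity S = {u. u \<in> borel_measurable (lebesgue_on S) \<and>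
                      (\<exists>B. AE t in lebesgue_on S. norm (u t) \<le> B)}"

definition configurations :: "real \<Rightarrow> ((real^3) \<times> (real^3)) set" where
  "configurations R = {(x, y). norm (x - y) > R}"

definition AC_curves :: "real \<Rightarrow> 'a::metric_space set \<Rightarrow> (real \<Rightarrow> 'a) set" where
  "AC_curves T S = {f. absolutely_continuous_on {0..T} f \<and> (\<forall>t\<in>{0..T}. f t \<in> S)}"

definition tensor :: "real^3 \<Rightarrow> real^3 \<Rightarrow> real^3^3" where
  "tensor v w = (\<chi> i j. v $ i * w $ j)"

definition mobility :: "real \<Rightarrow> real^3 \<Rightarrow> real^3^3" where
  "mobility a d =
     (3 * a / 4) *\<^sub>R ((1 / norm d) *\<^sub>R mat 1 + (1 / norm d ^ 3) *\<^sub>R tensor d d)"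

definition is_solution ::
  "real \<Rightarrow> real \<Rightarrow> real \<Rightarrow> (real \<Rightarrow> real^3) \<Rightarrow> (real^3) \<times> (real^3) \<Rightarrow>
     (real \<Rightarrow> real^3) \<Rightarrow> (real \<Rightarrow> real^3) \<Rightarrow> bool" where
  "is_solution a R T u p x y \<longleftrightarrow>
     (\<lambda>t. (x t, y t)) \<in> AC_curves T (configurations R) \<and>
     (x 0, y 0) = p \<and>
     (AE t in lebesgue_on {0..T}.
        (x has_vector_derivative u t) (at t within {0..T}) \<and>
        (y has_vector_derivative mobility a (y t - x t) *v u t) (at t within {0..T}))"

end

theory Submission
  imports Defs
begin

text \<open>
  The constant \<open>C = 2\<close> works. In the displacement \<open>d = y - x\<close> the system reads
  \<open>y' = M (y' - d')\<close>, where the mobility \<open>M\<close> has eigenvalues \<open>3a / (2|d|)\<close> along \<open>d\<close> and \<open>3a / (4|d|)\<close>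
  across it. Both are below \<open>1\<close> when \<open>|d| > 2a\<close>, so \<open>y' = - N(d) d'\<close> with
  \<open>N = M (1 - M)\<inverse>\<close>. Hence every path of \<open>d\<close> that avoids \<open>|d| \<le> R\<close> is realised by a control, and
  moves \<open>y\<close> by the line integral of a matrix-valued one-form. The form is not closed, and this is
  what allows \<open>y\<close> to be steered independently of \<open>d\<close>.

  Two kinds of arcs suffice, and the integral is explicit on both: rotations of \<open>d\<close> at constant distance
  (\<open>steers_rotation\<close>) and radial motions (\<open>steers_radial\<close>). Take a path that turns \<open>d\<close> to a direction
  \<open>n\<close>, moves out to a distance \<open>t\<close>, turns to \<open>- n\<close>, moves to the final distance and turns to the
  final direction. Its effect on \<open>y\<close> is a fixed vector plus a multiple of \<open>n\<close>. Turning at distance \<open>t\<close>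
  contributes a bounded amount, whereas the two radial motions contribute an amount that grows like
  \<open>ln t\<close>; by the intermediate value theorem the multiple takes every nonpositive value
  (\<open>radial_turning_distance\<close>). Choosing \<open>n\<close> and \<open>t\<close> suitably reaches any target
  (\<open>configurations_steers\<close>).

  Uniqueness holds for every essentially bounded control, because the mobility is Lipschitz on
  \<open>|d| \<ge> R\<close>. For absolutely continuous curves, Gronwall's inequality rests on the fact that an absolutely
  continuous function with nonpositive derivative almost everywhere does not increase
  (\<open>absolutely_continuous_nonincreasing\<close>).
\<close>

section \<open>Absolutely continuous curves\<close>

lemma division_real_memE:
  fixes D :: "real set set"
  assumes "D division_of S" "K \<in> D"
  obtains a b where "K = {a..b}" "a \<le> b" "Inf K = a" "Sup K = b" "a \<in> S" "b \<in> S"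
proof -
  obtain a b where K: "K = cbox a b" and ne: "K \<noteq> {}" and sub: "K \<subseteq> S"
    using division_ofD[OF assms(1)] assms(2) by metis
  from K ne have "a \<le> b" by simp
  then have "K = {a..b}" "Inf K = a" "Sup K = b" "a \<in> S" "b \<in> S"
    using K sub by auto
  then show ?thesis using that \<open>a \<le> b\<close> by blast
qed

lemma absolutely_continuous_onE:
  assumes "absolutely_continuous_on S f" "\<epsilon> > 0"
  obtains \<delta> where "\<delta> > 0"
    "\<forall>D. D division_of \<Union>D \<longrightarrow> \<Union>D \<subseteq> S \<longrightarrow> (\<Sum>K\<in>D. Sup K - Inf K) < \<delta> \<longrightarrow>
      (\<Sum>K\<in>D. dist (f (Inf K)) (f (Sup K))) < \<epsilon>"
proof -
  from assms obtain \<delta> where "\<delta> > 0" "\<forall>D. D division_of \<Union>D \<and> \<Union>D \<subseteq> S \<and>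
      (\<Sum>K\<in>D. Sup K - Inf K) < \<delta> \<longrightarrow> (\<Sum>K\<in>D. dist (f (Inf K)) (f (Sup K))) < \<epsilon>"
    unfolding absolutely_continuous_on_def by blast
  then show ?thesis using that by blast
qed

lemma absolutely_continuous_on_subset:
  assumes "absolutely_continuous_on S f" "T \<subseteq> S"
  shows "absolutely_continuous_on T f"
  unfolding absolutely_continuous_on_def
proof (intro allI impI)
  fix \<epsilon> :: real assume "\<epsilon> > 0"
  obtain \<delta> where "\<delta> > 0" and
    *: "\<forall>D. D division_of \<Union>D \<longrightarrow> \<Union>D \<subseteq> S \<longrightarrow> (\<Sum>K\<in>D. Sup K - Inf K) < \<delta> \<longrightarrow>
        (\<Sum>K\<in>D. dist (f (Inf K)) (f (Sup K))) < \<epsilon>"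
    using absolutely_continuous_onE[OF assms(1) \<open>\<epsilon> > 0\<close>] .
  show "\<exists>\<delta>>0. \<forall>D. D division_of \<Union>D \<and> \<Union>D \<subseteq> T \<and> (\<Sum>K\<in>D. Sup K - Inf K) < \<delta> \<longrightarrow>
        (\<Sum>K\<in>D. dist (f (Inf K)) (f (Sup K))) < \<epsilon>"
    using \<open>\<delta> > 0\<close> * assms(2) by blast
qed

text \<open>The source of the closure properties below: an estimate of increments
  on single intervals passes to the sums in the definition.\<close>

lemma absolutely_continuous_on_dominated:
  assumes f: "absolutely_continuous_on S f" and g: "absolutely_continuous_on S g"
    and L: "\<And>s t. s \<in> S \<Longrightarrow> t \<in> S \<Longrightarrow>
      dist (h s) (h t) \<le> L * (dist (f s) (f t) + dist (g s) (g t))"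
  shows "absolutely_continuous_on S h"
  unfolding absolutely_continuous_on_def
proof (intro allI impI)
  fix \<epsilon> :: real assume "\<epsilon> > 0"
  define M where "M = \<bar>L\<bar> + 1"
  have M: "M > 0" "L \<le> M" by (auto simp: M_def)
  define \<eta> where "\<eta> = \<epsilon> / (2 * M)"
  have \<eta>: "\<eta> > 0" using M \<open>\<epsilon> > 0\<close> by (simp add: \<eta>_def)
  obtain \<delta>1 where d1: "\<delta>1 > 0" and
    f: "\<forall>D. D division_of \<Union>D \<longrightarrow> \<Union>D \<subseteq> S \<longrightarrow> (\<Sum>K\<in>D. Sup K - Inf K) < \<delta>1 \<longrightarrow>
        (\<Sum>K\<in>D. dist (f (Inf K)) (f (Sup K))) < \<eta>"
    using absolutely_continuous_onE[OF f \<eta>] .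
  obtain \<delta>2 where d2: "\<delta>2 > 0" and
    g: "\<forall>D. D division_of \<Union>D \<longrightarrow> \<Union>D \<subseteq> S \<longrightarrow> (\<Sum>K\<in>D. Sup K - Inf K) < \<delta>2 \<longrightarrow>
        (\<Sum>K\<in>D. dist (g (Inf K)) (g (Sup K))) < \<eta>"
    using absolutely_continuous_onE[OF g \<eta>] .
  show "\<exists>\<delta>>0. \<forall>D. D division_of \<Union>D \<and> \<Union>D \<subseteq> S \<and> (\<Sum>K\<in>D. Sup K - Inf K) < \<delta> \<longrightarrow>
        (\<Sum>K\<in>D. dist (h (Inf K)) (h (Sup K))) < \<epsilon>"
  proof (intro exI[of _ "min \<delta>1 \<delta>2"] conjI allI impI)
    fix D :: "real set set"
    assume D: "D division_of \<Union>D \<and> \<Union>D \<subseteq> S \<and> (\<Sum>K\<in>D. Sup K - Inf K) < min \<delta>1 \<delta>2"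
    have "(\<Sum>K\<in>D. dist (h (Inf K)) (h (Sup K)))
        \<le> (\<Sum>K\<in>D. M * (dist (f (Inf K)) (f (Sup K)) + dist (g (Inf K)) (g (Sup K))))"
    proof (rule sum_mono)
      fix K assume "K \<in> D"
      then obtain a b where K: "Inf K = a" "Sup K = b" "a \<in> \<Union>D" "b \<in> \<Union>D"
        using division_real_memE D by metis
      then have "dist (h a) (h b) \<le> L * (dist (f a) (f b) + dist (g a) (g b))"
        using L D by blast
      also have "\<dots> \<le> M * (dist (f a) (f b) + dist (g a) (g b))"
        using M by (intro mult_right_mono) auto
      finally show "dist (h (Inf K)) (h (Sup K)) \<le>
          M * (dist (f (Inf K)) (f (Sup K)) + dist (g (Inf K)) (g (Sup K)))"
        by (simp add: K)
    qed
    also have "\<dots> = M * ((\<Sum>K\<in>D. dist (f (Inf K)) (f (Sup K))) +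
        (\<Sum>K\<in>D. dist (g (Inf K)) (g (Sup K))))"
      by (simp add: distrib_left sum_distrib_left sum.distrib)
    also have "\<dots> < M * (\<eta> + \<eta>)"
      using f[rule_format, of D] g[rule_format, of D] D M by (intro mult_strict_left_mono add_strict_mono) auto
    also have "\<dots> = \<epsilon>" using M by (simp add: \<eta>_def field_simps)
    finally show "(\<Sum>K\<in>D. dist (h (Inf K)) (h (Sup K))) < \<epsilon>" .
  qed (use d1 d2 in auto)
qed

lemma absolutely_continuous_on_ident: "absolutely_continuous_on S (\<lambda>t. t)"
  unfolding absolutely_continuous_on_def
proof (intro allI impI)
  fix \<epsilon> :: real assume "\<epsilon> > 0"
  have "(\<Sum>K\<in>D. dist (Inf K) (Sup K)) < \<epsilon>"
    if D: "D division_of \<Union>D" "(\<Sum>K\<in>D. Sup K - Inf K) < \<epsilon>" for D :: "real set set"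
  proof -
    have "dist (Inf K) (Sup K) = Sup K - Inf K" if "K \<in> D" for K
      using division_real_memE[OF D(1) that] by (metis abs_of_nonneg diff_ge_0_iff_ge
          dist_commute dist_real_def)
    then show ?thesis using D(2) by (simp cong: sum.cong)
  qed
  then show "\<exists>\<delta>>0. \<forall>D. D division_of \<Union>D \<and> \<Union>D \<subseteq> S \<and> (\<Sum>K\<in>D. Sup K - Inf K) < \<delta> \<longrightarrow>
        (\<Sum>K\<in>D. dist (Inf K) (Sup K)) < \<epsilon>"
    using \<open>\<epsilon> > 0\<close> by blast
qed

lemma lipschitz_imp_absolutely_continuous_on:
  assumes "L-lipschitz_on S f"
  shows "absolutely_continuous_on S f"
proof (rule absolutely_continuous_on_dominated[OF absolutely_continuous_on_ident
      absolutely_continuous_on_ident])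
  fix s t assume "s \<in> S" "t \<in> S"
  then show "dist (f s) (f t) \<le> L * (dist s t + dist s t)"
    using lipschitz_onD[OF assms, of s t] lipschitz_on_nonneg[OF assms]
    by (smt (verit) mult_left_mono zero_le_dist)
qed

lemma absolutely_continuous_on_imp_continuous_on:
  assumes "absolutely_continuous_on {a..b} f"
  shows "continuous_on {a..b} f"
  unfolding continuous_on_iff
proof (intro ballI allI impI)
  fix x \<epsilon> :: real assume x: "x \<in> {a..b}" and "\<epsilon> > 0"
  obtain \<delta> where "\<delta> > 0" and
    *: "\<forall>D. D division_of \<Union>D \<longrightarrow> \<Union>D \<subseteq> {a..b} \<longrightarrow> (\<Sum>K\<in>D. Sup K - Inf K) < \<delta> \<longrightarrow>
        (\<Sum>K\<in>D. dist (f (Inf K)) (f (Sup K))) < \<epsilon>"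
    using absolutely_continuous_onE[OF assms \<open>\<epsilon> > 0\<close>] .
  have **: "dist (f s) (f t) < \<epsilon>" if "s \<in> {a..b}" "t \<in> {a..b}" "s \<le> t" "t - s < \<delta>" for s t
    using *[rule_format, of "{{s..t}}"] that division_of_self[of s t] by auto
  have "dist (f y) (f x) < \<epsilon>" if "y \<in> {a..b}" "dist y x < \<delta>" for y
    using **[of x y] **[of y x] that x
    by (cases "x \<le> y") (auto simp: dist_real_def dist_commute)
  then show "\<exists>d>0. \<forall>x'\<in>{a..b}. dist x' x < d \<longrightarrow> dist (f x') (f x) < \<epsilon>"
    using \<open>\<delta> > 0\<close> by blast
qed

lemma absolutely_continuous_on_bounded_bilinear:
  fixes f :: "real \<Rightarrow> 'a::real_normed_vector" and g :: "real \<Rightarrow> 'b::real_normed_vector"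
    and prod :: "'a \<Rightarrow> 'b \<Rightarrow> 'c::real_normed_vector"
  assumes prod: "bounded_bilinear prod"
    and f: "absolutely_continuous_on {a..b} f" and g: "absolutely_continuous_on {a..b} g"
  shows "absolutely_continuous_on {a..b} (\<lambda>t. prod (f t) (g t))"
proof -
  interpret bounded_bilinear prod by fact
  have "bounded (f ` {a..b})" "bounded (g ` {a..b})"
    using f g by (auto intro!: compact_imp_bounded compact_continuous_image
        absolutely_continuous_on_imp_continuous_on)
  then obtain A B where A: "\<And>t. t \<in> {a..b} \<Longrightarrow> norm (f t) \<le> A" 
    and B: "\<And>t. t \<in> {a..b} \<Longrightarrow> norm (g t) \<le> B"
    unfolding bounded_iff by (meson imageI)
  obtain K where K: "K \<ge> 0" "\<And>u v. norm (prod u v) \<le> norm u * norm v * K"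
    using nonneg_bounded by blast
  define M where "M = \<bar>A\<bar> + \<bar>B\<bar>"
  show ?thesis
  proof (rule absolutely_continuous_on_dominated[OF f g])
    fix s t assume st: "s \<in> {a..b}" "t \<in> {a..b}"
    have nA: "norm (f s) \<le> M" and nB: "norm (g t) \<le> M"
      using A[OF st(1)] B[OF st(2)] by (auto simp: M_def)
    have "prod (f s) (g s) - prod (f t) (g t) = prod (f s) (g s - g t) + prod (f s - f t) (g t)"
      by (simp add: diff_left diff_right)
    then have "norm (prod (f s) (g s) - prod (f t) (g t))
        \<le> norm (f s) * norm (g s - g t) * K + norm (f s - f t) * norm (g t) * K"
      using K(2) norm_triangle_le add_mono by metis
    also have "\<dots> \<le> M * norm (g s - g t) * K + norm (f s - f t) * M * K"
      using nA nB K(1) by (intro add_mono mult_right_mono mult_left_mono) auto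
    also have "\<dots> = K * M * (norm (f s - f t) + norm (g s - g t))"
      by (simp add: algebra_simps)
    finally show "dist (prod (f s) (g s)) (prod (f t) (g t)) \<le>
        K * M * (dist (f s) (f t) + dist (g s) (g t))"
      by (simp add: dist_norm)
  qed
qed

lemma absolutely_continuous_on_diff:
  fixes f g :: "real \<Rightarrow> 'a::real_normed_vector"
  assumes "absolutely_continuous_on S f" "absolutely_continuous_on S g"
  shows "absolutely_continuous_on S (\<lambda>t. f t - g t)"
proof (rule absolutely_continuous_on_dominated[OF assms])
  show "dist (f s - g s) (f t - g t) \<le> 1 * (dist (f s) (f t) + dist (g s) (g t))" for s t
    using norm_triangle_ineq4[of "f s - f t" "g s - g t"] by (simp add: dist_norm algebra_simps)
qed

lemma sum_length_division_le_measure: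
  fixes D :: "real set set"
  assumes D: "D division_of \<Union>D" and G: "G \<in> lmeasurable" "\<Union>D \<subseteq> G"
  shows "(\<Sum>K\<in>D. Sup K - Inf K) \<le> measure lebesgue G"
proof -
  have fin: "finite D" using D by blast
  have len: "Sup K - Inf K = measure lebesgue (interior K)" 
    and op: "interior K \<in> lmeasurable" if "K \<in> D" for K
    using division_real_memE[OF D that] by (force, force)
  have "(\<Sum>K\<in>D. Sup K - Inf K) = (\<Sum>K\<in>D. measure lebesgue (interior K))"
    using len by simp
  also have "\<dots> = measure lebesgue (\<Union>(interior ` D))"
  proof (rule measure_negligible_finite_Union_image[symmetric, OF fin op])
    show "pairwise (\<lambda>K L. negligible (interior K \<inter> interior L)) D"
      using division_ofD(5)[OF D] by (simp add: pairwise_def)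
  qed
  also have "\<dots> \<le> measure lebesgue G"
  proof (rule measure_mono_fmeasurable)
    show "\<Union>(interior ` D) \<subseteq> G" using G(2) interior_subset by blast
    have "open (\<Union>(interior ` D))" by auto
    then show "\<Union>(interior ` D) \<in> sets lebesgue" by (simp add: borel_open)
  qed (use G(1) in auto)
  finally show ?thesis .
qed

lemma negligible_outer_open:
  fixes N :: "real set"
  assumes "negligible N" "\<delta> > 0"
  obtains G where "open G" "N \<subseteq> G" "G \<in> lmeasurable" "measure lebesgue G < \<delta>"
proof -
  have N: "N \<in> null_sets lebesgue" using assms(1) by (simp add: negligible_iff_null_sets)
  then obtain G where G: "open G" "N \<subseteq> G" "G - N \<in> lmeasurable"
      "emeasure lebesgue (G - N) < ennreal \<delta>"
    using sets_lebesgue_outer_open[OF _ assms(2), of N] by blast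
  have eq: "G = (G - N) \<union> N" using G(2) by blast
  have "N \<in> lmeasurable" "measure lebesgue N = 0"
    using assms(1) negligible_imp_measurable negligible_imp_measure0 by auto
  then have "G \<in> lmeasurable" using eq G(3) fmeasurable.Un by metis
  moreover have "measure lebesgue G = measure lebesgue (G - N)"
    using measure_Diff_null_set[of G lebesgue N] N \<open>open G\<close> by auto
  moreover have "measure lebesgue (G - N) < \<delta>"
    using G(3,4) assms(2) by (simp add: emeasure_eq_measure2 fmeasurableD ennreal_less_iff)
  ultimately show ?thesis using that G(1,2) by metis
qed

text \<open>The fundamental theorem of calculus in the form of a one-sided estimate. The telescoping sum
  \<open>f b - f a\<close> over a sufficiently fine tagged division splits in two. On the intervals tagged outside
  the exceptional set, \<open>f\<close> rises by at most \<open>\<epsilon>\<close> times the length because of the derivative. The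
  intervals tagged in the exceptional set lie in an open set of small measure, and absolute
  continuity makes their contribution small.\<close>

lemma absolutely_continuous_nonincreasing:
  fixes f :: "real \<Rightarrow> real"
  assumes ab: "a \<le> b" and ac: "absolutely_continuous_on {a..b} f"
    and N: "negligible N"
    and der: "\<And>t. t \<in> {a..b} - N \<Longrightarrow>
      \<exists>D\<le>0. (f has_vector_derivative D) (at t within {a..b})"
  shows "f b \<le> f a"
proof (rule field_le_epsilon)
  fix e :: real assume "e > 0"
  define \<epsilon> where "\<epsilon> = e / (b - a + 1)"
  have \<epsilon>: "\<epsilon> > 0" "\<epsilon> * (b - a) + \<epsilon> = e"
  proof -
    show "\<epsilon> > 0" using \<open>e > 0\<close> ab by (simp add: \<epsilon>_def)
    have "\<epsilon> * (b - a) + \<epsilon> = \<epsilon> * (b - a + 1)" by (simp add: algebra_simps)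
    also have "\<dots> = e" using ab by (simp add: \<epsilon>_def)
    finally show "\<epsilon> * (b - a) + \<epsilon> = e" .
  qed
  obtain \<delta> where "\<delta> > 0" and
    small: "\<forall>D. D division_of \<Union>D \<longrightarrow> \<Union>D \<subseteq> {a..b} \<longrightarrow> (\<Sum>K\<in>D. Sup K - Inf K) < \<delta> \<longrightarrow>
        (\<Sum>K\<in>D. dist (f (Inf K)) (f (Sup K))) < \<epsilon>"
    using absolutely_continuous_onE[OF ac \<epsilon>(1)] .
  obtain G where G: "open G" "N \<subseteq> G" "G \<in> lmeasurable" "measure lebesgue G < \<delta>"
    using negligible_outer_open[OF N \<open>\<delta> > 0\<close>] .
  have "\<exists>r>0. \<forall>u v. u \<in> {a..b} \<and> v \<in> {a..b} \<and> u \<le> t \<and> t \<le> v \<and> u \<in> ball t r \<and> v \<in> ball t r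
      \<longrightarrow> f v - f u \<le> \<epsilon> * (v - u)" if t: "t \<in> {a..b} - N" for t
  proof -
    obtain D where D: "D \<le> 0" "(f has_vector_derivative D) (at t within {a..b})"
      using der[OF t] by blast
    then obtain r where r: "r > 0" "\<And>s. s \<in> {a..b} \<Longrightarrow> norm (s - t) < r \<Longrightarrow>
        norm (f s - f t - (s - t) *\<^sub>R D) \<le> \<epsilon> * norm (s - t)"
      using \<epsilon>(1) unfolding has_vector_derivative_def has_derivative_within_alt by metis
    have "f v - f u \<le> \<epsilon> * (v - u)" if uv: "u \<in> {a..b}" "v \<in> {a..b}" "u \<le> t" "t \<le> v" 
      "u \<in> ball t r" "v \<in> ball t r" for u v
    proof -
      have "\<bar>f v - f t - (v - t) * D\<bar> \<le> \<epsilon> * (v - t)" "\<bar>f u - f t - (u - t) * D\<bar> \<le> \<epsilon> * (t - u)"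
        using r(2)[of v] r(2)[of u] uv by (auto simp: dist_real_def)
      moreover have "(v - t) * D - (u - t) * D \<le> 0"
        using D(1) uv by (simp add: mult_nonneg_nonpos flip: left_diff_distrib)
      ultimately show ?thesis by (simp add: algebra_simps)
    qed
    then show ?thesis using r(1) by blast
  qed
  then obtain r where r: "\<And>t. t \<in> {a..b} - N \<Longrightarrow> r t > 0" 
    and inc: "\<And>t u v. \<lbrakk>t \<in> {a..b} - N; u \<in> {a..b}; v \<in> {a..b}; u \<le> t; t \<le> v; 
      u \<in> ball t (r t); v \<in> ball t (r t)\<rbrakk> \<Longrightarrow> f v - f u \<le> \<epsilon> * (v - u)"
    by metis
  \<comment> \<open>Intervals tagged in \<open>N\<close> are confined to \<open>G\<close>, all others to where the derivative controls \<open>f\<close>.\<close>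
  define \<gamma> where "\<gamma> t = (if t \<in> N then G else if t \<in> {a..b} then ball t (r t) else UNIV)" for t
  have "gauge \<gamma>" using G r by (auto simp: gauge_def \<gamma>_def)
  then obtain p where p: "p tagged_division_of {a..b}" "\<gamma> fine p"
    using fine_division_exists_real by blast
  note pD = tagged_division_ofD[OF p(1)]
  define q where "q = {(t, K) \<in> p. t \<in> N}"
  have qp: "q \<subseteq> p" "finite p" using pD(1) by (auto simp: q_def)
  then have finq: "finite q" using finite_subset by blast
  have q_part: "q tagged_partial_division_of {a..b}"
    using tagged_partial_division_subset p(1) qp(1) tagged_division_of_def by metis
  have mem: "\<exists>u v. K = {u..v} \<and> u \<le> t \<and> t \<le> v \<and> u \<in> {a..b} \<and> v \<in> {a..b}"
    if tK: "(t, K) \<in> p" for t K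
  proof -
    obtain u v where K: "K = {u..v}" using pD(4)[OF tK] by auto
    moreover have "u \<le> t" "t \<le> v" using pD(2)[OF tK] K by auto
    moreover have "u \<in> {a..b}" "v \<in> {a..b}" using pD(3)[OF tK] K calculation by auto
    ultimately show ?thesis by blast
  qed
  have "f b - f a = (\<Sum>(t, K)\<in>p. f (Sup K) - f (Inf K))"
    using additive_tagged_division_1[OF ab p(1), of f] by simp
  also have "\<dots> = (\<Sum>(t, K)\<in>p - q. f (Sup K) - f (Inf K)) + (\<Sum>(t, K)\<in>q. f (Sup K) - f (Inf K))"
    using qp by (simp add: sum.subset_diff)
  also have "\<dots> \<le> \<epsilon> * (b - a) + \<epsilon>"
  proof (rule add_mono)
    have "(\<Sum>(t, K)\<in>p - q. f (Sup K) - f (Inf K)) \<le> (\<Sum>(t, K)\<in>p - q. \<epsilon> * (Sup K - Inf K))"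
    proof (rule sum_mono, clarify)
      fix t K assume tK: "(t, K) \<in> p" "(t, K) \<notin> q"
      obtain u v where K: "K = {u..v}" "u \<le> t" "t \<le> v" "u \<in> {a..b}" "v \<in> {a..b}"
        using mem[OF tK(1)] by blast
      have t: "t \<in> {a..b} - N" using K tK by (auto simp: q_def)
      then have "K \<subseteq> ball t (r t)" using fineD[OF p(2) tK(1)] by (simp add: \<gamma>_def)
      moreover have "u \<in> K" "v \<in> K" using K by auto
      ultimately have "f v - f u \<le> \<epsilon> * (v - u)" using inc[OF t K(4,5,2,3)] by blast
      then show "f (Sup K) - f (Inf K) \<le> \<epsilon> * (Sup K - Inf K)" using K by simp
    qed
    also have "\<dots> \<le> (\<Sum>(t, K)\<in>p. \<epsilon> * (Sup K - Inf K))"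
    proof (rule sum_mono2)
      fix tK assume "tK \<in> p - (p - q)"
      then obtain t K where tK: "tK = (t, K)" "(t, K) \<in> p" by (cases tK) auto
      obtain u v where "K = {u..v}" "u \<le> v" using mem[OF tK(2)] by force
      then show "0 \<le> (case tK of (t, K) \<Rightarrow> \<epsilon> * (Sup K - Inf K))"
        using tK(1) \<epsilon>(1) by simp
    qed (use qp in auto)
    also have "\<dots> = (\<Sum>(t, K)\<in>p. \<epsilon> * Sup K - \<epsilon> * Inf K)"
      by (simp add: right_diff_distrib)
    also have "\<dots> = \<epsilon> * (b - a)"
      using additive_tagged_division_1[OF ab p(1), of "\<lambda>t. \<epsilon> * t"] by (simp add: right_diff_distrib)
    finally show "(\<Sum>(t, K)\<in>p - q. f (Sup K) - f (Inf K)) \<le> \<epsilon> * (b - a)" .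
  next
    \<comment> \<open>A tagged division may repeat a degenerate interval with several tags; such intervals
      contribute nothing, so the sum over tagged intervals is one over intervals.\<close>
    define g where "g K = (if K = {} then 0 else dist (f (Inf K)) (f (Sup K)))" for K
    have ne: "K \<noteq> {}" if "(t, K) \<in> q" for t K
      using pD(2) that qp(1) by blast
    have "(\<Sum>(t, K)\<in>q. f (Sup K) - f (Inf K)) \<le> (\<Sum>(t, K)\<in>q. g K)"
      using ne by (intro sum_mono) (auto simp: dist_real_def g_def)
    also have "\<dots> = (\<Sum>K\<in>snd ` q. g K)"
    proof (rule sum.over_tagged_division_lemma[OF tagged_partial_division_of_Union_self[OF q_part]])
      fix u v :: real assume "box u v = {}"
      then show "g (cbox u v) = 0"
        by (cases "u = v") (auto simp: g_def)
    qed
    also have "\<dots> = (\<Sum>K\<in>snd ` q. dist (f (Inf K)) (f (Sup K)))"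
      using ne by (intro sum.cong) (auto simp: g_def)
    also have "\<dots> < \<epsilon>"
    proof (rule small[rule_format])
      show div: "snd ` q division_of \<Union>(snd ` q)"
        by (rule partial_division_of_tagged_division[OF q_part])
      show "\<Union>(snd ` q) \<subseteq> {a..b}" using pD(3) qp by force
      have "\<Union>(snd ` q) \<subseteq> G"
        using fineD[OF p(2)] by (fastforce simp: q_def \<gamma>_def)
      then show "(\<Sum>K\<in>snd ` q. Sup K - Inf K) < \<delta>"
        using sum_length_division_le_measure[OF div G(3)] G(4) by simp
    qed
    finally show "(\<Sum>(t, K)\<in>q. f (Sup K) - f (Inf K)) \<le> \<epsilon>" by simp
  qed
  finally show "f b \<le> f a + e" using \<epsilon>(2) by simp
qed

text \<open>Gronwall's argument: \<open>exp (- 2 L t) |z - z'|\<^sup>2\<close> is absolutely continuous, starts at zero and has a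
  nonpositive derivative almost everywhere. The Lipschitz bound is asked only along the two
  curves, because the field at hand is not Lipschitz near collision.\<close>

lemma absolutely_continuous_ode_unique:
  fixes z z' :: "real \<Rightarrow> 'a::real_inner"
  assumes ac: "absolutely_continuous_on {0..T} z" "absolutely_continuous_on {0..T} z'"
    and init: "z 0 = z' 0" and N: "negligible N"
    and der: "\<And>t. t \<in> {0..T} - N \<Longrightarrow> \<exists>v v'. (z has_vector_derivative v) (at t within {0..T}) \<and>
      (z' has_vector_derivative v') (at t within {0..T}) \<and> norm (v - v') \<le> L * norm (z t - z' t)"
    and t: "t \<in> {0..T}"
  shows "z t = z' t"
proof -
  define w where "w s = z s - z' s" for s
  define \<psi> where "\<psi> s = exp (- 2 * L * s) *\<^sub>R (w s \<bullet> w s)" for s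
  have acw: "absolutely_continuous_on {0..t} w"
    unfolding w_def using t
    by (intro absolutely_continuous_on_subset[OF absolutely_continuous_on_diff[OF ac]]) auto
  have "\<exists>C. C-lipschitz_on {0..t} (\<lambda>s. exp (- 2 * L * s) :: real)"
  proof -
    have "continuous_on {0..t} (\<lambda>s. exp (- 2 * L * s) * (2 * L))" by (intro continuous_intros)
    then have "bounded ((\<lambda>s. exp (- 2 * L * s) * (2 * L)) ` {0..t})"
      by (intro compact_imp_bounded compact_continuous_image) auto
    then obtain B where B: "\<And>s. s \<in> {0..t} \<Longrightarrow> \<bar>exp (- 2 * L * s) * (2 * L)\<bar> \<le> B"
      unfolding bounded_iff real_norm_def by (meson imageI)
    have "\<bar>B\<bar>-lipschitz_on {0..t} (\<lambda>s. exp (- 2 * L * s) :: real)"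
    proof (rule bounded_derivative_imp_lipschitz)
      fix s assume "s \<in> {0..t}"
      show "((\<lambda>s. exp (- 2 * L * s) :: real) has_derivative 
          (\<lambda>h. h *\<^sub>R (- (exp (- 2 * L * s) * (2 * L))))) (at s within {0..t})"
        by (auto intro!: derivative_eq_intros)
      show "onorm (\<lambda>h. h *\<^sub>R (- (exp (- 2 * L * s) * (2 * L)))) \<le> \<bar>B\<bar>"
      proof (rule onorm_bound)
        fix h :: real
        have "\<bar>exp (- 2 * L * s) * (2 * L)\<bar> \<le> \<bar>B\<bar>" using B[OF \<open>s \<in> {0..t}\<close>] by linarith
        then have "\<bar>h\<bar> * \<bar>exp (- 2 * L * s) * (2 * L)\<bar> \<le> \<bar>h\<bar> * \<bar>B\<bar>"
          by (intro mult_left_mono) auto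
        then show "norm (h *\<^sub>R (- (exp (- 2 * L * s) * (2 * L)))) \<le> \<bar>B\<bar> * norm h"
          by (simp add: abs_mult mult.commute mult.left_commute)
      qed simp
    qed auto
    then show ?thesis by blast
  qed
  then have "absolutely_continuous_on {0..t} \<psi>"
    unfolding \<psi>_def
    by (intro absolutely_continuous_on_bounded_bilinear[OF bounded_bilinear_scaleR]
        absolutely_continuous_on_bounded_bilinear[OF bounded_bilinear_inner] acw)
      (auto intro: lipschitz_imp_absolutely_continuous_on)
  then have "\<psi> t \<le> \<psi> 0"
  proof (rule absolutely_continuous_nonincreasing[rotated, OF _ N])
    fix s assume s: "s \<in> {0..t} - N"
    then obtain v v' where v: "(z has_vector_derivative v) (at s within {0..T})"
      "(z' has_vector_derivative v') (at s within {0..T})" "norm (v - v') \<le> L * norm (w s)"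
      using der[of s] t by (auto simp: w_def)
    have wd: "(w has_vector_derivative v - v') (at s within {0..t})"
      unfolding w_def using t
      by (intro has_vector_derivative_diff has_vector_derivative_within_subset[OF v(1)]
          has_vector_derivative_within_subset[OF v(2)]) auto
    define D where "D = exp (- 2 * L * s) * (2 * (w s \<bullet> (v - v')) - 2 * L * (w s \<bullet> w s))"
    have "(\<psi> has_vector_derivative D) (at s within {0..t})"
      unfolding \<psi>_def D_def has_vector_derivative_def
      by (rule derivative_eq_intros wd[unfolded has_vector_derivative_def] refl)+
        (auto simp: fun_eq_iff algebra_simps inner_commute)
    moreover have "D \<le> 0"
    proof -
      have "w s \<bullet> (v - v') \<le> norm (w s) * norm (v - v')" by (rule norm_cauchy_schwarz)
      also have "\<dots> \<le> norm (w s) * (L * norm (w s))" using v(3) by (intro mult_left_mono) auto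
      also have "\<dots> = L * (w s \<bullet> w s)" by (simp add: dot_square_norm power2_eq_square)
      finally show ?thesis unfolding D_def by (intro mult_nonneg_nonpos) auto
    qed
    ultimately show "\<exists>D\<le>0. (\<psi> has_vector_derivative D) (at s within {0..t})" by blast
  qed (use t in auto)
  then have "exp (- 2 * L * t) * (w t \<bullet> w t) \<le> 0"
    using init by (simp add: \<psi>_def w_def)
  then have "w t \<bullet> w t \<le> 0" by (simp add: mult_le_0_iff)
  then have "w t = 0" by (metis inner_gt_zero_iff not_le)
  then show ?thesis by (simp add: w_def)
qed

section \<open>The mobility tensor\<close>

lemma tensor_mult_vector: "tensor v w *v x = (w \<bullet> x) *\<^sub>R v"
  by (simp add: vec_eq_iff tensor_def matrix_vector_mult_def inner_vec_def sum_distrib_right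
      sum_distrib_left mult_ac)

lemma mobility_mult_vector:
  "mobility a d *v w =
     (3 * a / 4) *\<^sub>R ((1 / norm d) *\<^sub>R w + ((d \<bullet> w) / norm d ^ 3) *\<^sub>R d)"
  by (simp add: mobility_def scaleR_matrix_vector_assoc[symmetric] matrix_vector_mult_add_rdistrib
      tensor_mult_vector algebra_simps)

lemma mobility_orthogonal:
  assumes "d \<bullet> w = 0"
  shows "mobility a d *v w = (3 * a / (4 * norm d)) *\<^sub>R w"
  by (simp add: mobility_mult_vector assms)

lemma mobility_parallel:
  assumes "norm e = 1" "r > 0"
  shows "mobility a (r *\<^sub>R e) *v (c *\<^sub>R e) = (3 * a * c / (2 * r)) *\<^sub>R e"
proof -
  have "e \<bullet> e = 1" using assms(1) by (simp add: dot_square_norm)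
  then show ?thesis using assms
    by (simp add: mobility_mult_vector scaleR_add_left[symmetric] field_simps power3_eq_cube
      flip: scaleR_add_left)
qed

text \<open>Away from collision, \<open>d \<mapsto> 1/|d|\<close> and \<open>d \<mapsto> d/|d|\<close> are Lipschitz with constants \<open>1/R\<^sup>2\<close> and \<open>2/R\<close>,
  and the mobility is a polynomial in these two bounded functions.\<close>

lemma mobility_lipschitz:
  assumes R: "R > 0" "norm d \<ge> R" "norm d' \<ge> R"
  shows "norm (mobility a d *v w - mobility a d' *v w)
    \<le> (3 * \<bar>a\<bar> / 4) * (6 / R\<^sup>2 * norm w * norm (d - d'))"
proof -
  define s s' where "s = 1 / norm d" and "s' = 1 / norm d'"
  define e e' where "e = s *\<^sub>R d" and "e' = s' *\<^sub>R d'"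
  define \<delta> where "\<delta> = norm (d - d')"
  have d: "norm d > 0" "norm d' > 0" using R by linarith+
  have s: "0 \<le> s" "s \<le> 1 / R"
    using R d by (auto simp: s_def intro!: divide_left_mono mult_pos_pos)
  have ne: "norm e = 1" "norm e' = 1" using d by (auto simp: e_def e'_def s_def s'_def)
  have nd: "\<bar>norm d' - norm d\<bar> \<le> \<delta>" 
    unfolding \<delta>_def by (metis norm_minus_commute norm_triangle_ineq3)
  have ss: "s - s' = (norm d' - norm d) / (norm d * norm d')"
    using d by (simp add: s_def s'_def field_simps)
  have abs_ss: "\<bar>s - s'\<bar> = \<bar>norm d' - norm d\<bar> / (norm d * norm d')"
    using d by (simp add: ss abs_mult)
  also have "\<dots> \<le> \<delta> / (R * R)"
    using R nd d by (intro frac_le mult_mono) auto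
  finally have dss: "\<bar>s - s'\<bar> \<le> \<delta> / R\<^sup>2" by (simp add: power2_eq_square)
  have "e - e' = s *\<^sub>R (d - d') + (s - s') *\<^sub>R d'"
    by (simp add: e_def e'_def algebra_simps)
  then have "norm (e - e') \<le> s * \<delta> + \<bar>s - s'\<bar> * norm d'"
    using norm_triangle_ineq[of "s *\<^sub>R (d - d')" "(s - s') *\<^sub>R d'"] s by (simp add: \<delta>_def)
  also have "\<bar>s - s'\<bar> * norm d' = s * \<bar>norm d' - norm d\<bar>"
    unfolding abs_ss using d by (simp add: s_def)
  also have "s * \<delta> + s * \<bar>norm d' - norm d\<bar> \<le> (1 / R) * \<delta> + (1 / R) * \<delta>"
    using s nd R(1) by (intro add_mono mult_mono) (auto simp: \<delta>_def)
  finally have de: "norm (e - e') \<le> 2 * \<delta> / R" by simp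
  have M: "mobility a d *v w = (3 * a / 4) *\<^sub>R (s *\<^sub>R w + (s * (e \<bullet> w)) *\<^sub>R e)"
      "mobility a d' *v w = (3 * a / 4) *\<^sub>R (s' *\<^sub>R w + (s' * (e' \<bullet> w)) *\<^sub>R e')"
    by (simp_all add: mobility_mult_vector s_def s'_def e_def e'_def power3_eq_cube)
  have "mobility a d *v w - mobility a d' *v w = (3 * a / 4) *\<^sub>R
      ((s - s') *\<^sub>R w + (s * (e \<bullet> w)) *\<^sub>R (e - e') + (s * ((e - e') \<bullet> w)) *\<^sub>R e'
        + ((s - s') * (e' \<bullet> w)) *\<^sub>R e')"
    unfolding M by (simp add: algebra_simps)
  also have "norm \<dots> = (3 * \<bar>a\<bar> / 4) * norm
      ((s - s') *\<^sub>R w + (s * (e \<bullet> w)) *\<^sub>R (e - e') + (s * ((e - e') \<bullet> w)) *\<^sub>R e'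
        + ((s - s') * (e' \<bullet> w)) *\<^sub>R e')"
    by (simp add: abs_mult)
  also have "\<dots> \<le> (3 * \<bar>a\<bar> / 4) * (6 / R\<^sup>2 * norm w * \<delta>)"
  proof (rule mult_left_mono)
    have cs: "\<bar>v \<bullet> w\<bar> \<le> norm v * norm w" for v by (rule Cauchy_Schwarz_ineq2)
    have 1: "norm ((s - s') *\<^sub>R w) \<le> \<delta> / R\<^sup>2 * norm w"
      unfolding norm_scaleR by (rule mult_right_mono[OF dss norm_ge_zero])
    have "norm ((s * (e \<bullet> w)) *\<^sub>R (e - e')) = s * \<bar>e \<bullet> w\<bar> * norm (e - e')"
      using s by (simp add: abs_mult)
    also have "\<dots> \<le> (1 / R) * norm w * (2 * \<delta> / R)"
      using s de cs[of e] ne R(1) by (intro mult_mono) auto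
    finally have 2: "norm ((s * (e \<bullet> w)) *\<^sub>R (e - e')) \<le> 2 * (\<delta> / R\<^sup>2 * norm w)"
      by (simp add: power2_eq_square mult_ac)
    have "norm ((s * ((e - e') \<bullet> w)) *\<^sub>R e') = s * \<bar>(e - e') \<bullet> w\<bar>"
      using s ne by (simp add: abs_mult)
    also have "\<dots> \<le> s * (norm (e - e') * norm w)"
      using s cs by (intro mult_left_mono) auto
    also have "\<dots> \<le> (1 / R) * ((2 * \<delta> / R) * norm w)"
      using s de R(1) by (intro mult_mono mult_right_mono) auto
    finally have 3: "norm ((s * ((e - e') \<bullet> w)) *\<^sub>R e') \<le> 2 * (\<delta> / R\<^sup>2 * norm w)"
      by (simp add: power2_eq_square mult_ac)
    have "norm (((s - s') * (e' \<bullet> w)) *\<^sub>R e') = \<bar>s - s'\<bar> * \<bar>e' \<bullet> w\<bar>"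
      using ne by (simp add: abs_mult)
    also have "\<dots> \<le> \<delta> / R\<^sup>2 * norm w"
      using dss cs[of e'] ne by (intro mult_mono) (auto simp: \<delta>_def)
    finally have 4: "norm (((s - s') * (e' \<bullet> w)) *\<^sub>R e') \<le> \<delta> / R\<^sup>2 * norm w" .
    have "norm ((s - s') *\<^sub>R w + (s * (e \<bullet> w)) *\<^sub>R (e - e') + (s * ((e - e') \<bullet> w)) *\<^sub>R e'
        + ((s - s') * (e' \<bullet> w)) *\<^sub>R e') \<le> \<delta> / R\<^sup>2 * norm w + 2 * (\<delta> / R\<^sup>2 * norm w)
        + 2 * (\<delta> / R\<^sup>2 * norm w) + \<delta> / R\<^sup>2 * norm w"
      by (intro norm_triangle_mono 1 2 3 4)
    also have "\<dots> = 6 / R\<^sup>2 * norm w * \<delta>" by (simp add: field_simps)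
    finally show "norm ((s - s') *\<^sub>R w + (s * (e \<bullet> w)) *\<^sub>R (e - e')
        + (s * ((e - e') \<bullet> w)) *\<^sub>R e' + ((s - s') * (e' \<bullet> w)) *\<^sub>R e')
      \<le> 6 / R\<^sup>2 * norm w * \<delta>" .
  qed simp
  finally show ?thesis by (simp add: \<delta>_def)
qed

section \<open>Uniqueness of solutions\<close>

lemma AE_lebesgue_on_imp_negligible:
  assumes "AE t in lebesgue_on S. P t" "S \<in> sets lebesgue"
  obtains N where "negligible N" "\<And>t. t \<in> S - N \<Longrightarrow> P t"
proof -
  obtain N where N: "N \<in> null_sets (lebesgue_on S)" "{t \<in> space (lebesgue_on S). \<not> P t} \<subseteq> N"
    using assms(1) unfolding eventually_ae_filter by blast
  have "negligible N"
    using N(1) assms(2) by (simp add: null_sets_restrict_space negligible_iff_null_sets)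
  then show ?thesis using that N(2) by auto
qed

text \<open>Both solutions keep the particles at distance at least \<open>R\<close>, where the velocity field is Lipschitz
  uniformly in time, since the control is essentially bounded.\<close>

lemma is_solution_unique:
  assumes R: "R > 0" and u: "u \<in> L_infinity {0..T}"
    and sol: "is_solution a R T u p x y" and sol': "is_solution a R T u p x' y'"
    and t: "t \<in> {0..T}"
  shows "x' t = x t \<and> y' t = y t"
proof -
  obtain B where B: "AE t in lebesgue_on {0..T}. norm (u t) \<le> B"
    using u by (auto simp: L_infinity_def)
  have AE: "AE t in lebesgue_on {0..T}. norm (u t) \<le> B \<and>
      (x has_vector_derivative u t) (at t within {0..T}) \<and>
      (y has_vector_derivative mobility a (y t - x t) *v u t) (at t within {0..T}) \<and>
      (x' has_vector_derivative u t) (at t within {0..T}) \<and>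
      (y' has_vector_derivative mobility a (y' t - x' t) *v u t) (at t within {0..T})"
    using B sol sol' unfolding is_solution_def by auto
  obtain N where N: "negligible N" and der: "\<And>t. t \<in> {0..T} - N \<Longrightarrow> norm (u t) \<le> B \<and>
      (x has_vector_derivative u t) (at t within {0..T}) \<and>
      (y has_vector_derivative mobility a (y t - x t) *v u t) (at t within {0..T}) \<and>
      (x' has_vector_derivative u t) (at t within {0..T}) \<and>
      (y' has_vector_derivative mobility a (y' t - x' t) *v u t) (at t within {0..T})"
    using AE_lebesgue_on_imp_negligible[OF AE] by auto
  define K where "K = (3 * \<bar>a\<bar> / 4) * (6 / R\<^sup>2 * B)"
  have "(x' t, y' t) = (x t, y t)"
  proof (rule absolutely_continuous_ode_unique[where z = "\<lambda>t. (x' t, y' t)" and z' = "\<lambda>t. (x t, y t)"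
        and N = N and L = "2 * K" and T = T])
    show "absolutely_continuous_on {0..T} (\<lambda>t. (x' t, y' t))" 
      "absolutely_continuous_on {0..T} (\<lambda>t. (x t, y t))" "(x' 0, y' 0) = (x 0, y 0)"
      using sol sol' by (auto simp: is_solution_def AC_curves_def)
    fix t assume t: "t \<in> {0..T} - N"
    let ?v' = "(u t, mobility a (y' t - x' t) *v u t)" and ?v = "(u t, mobility a (y t - x t) *v u t)"
    let ?\<delta> = "norm ((y' t - x' t) - (y t - x t))"
    have conf: "norm (y t - x t) \<ge> R" "norm (y' t - x' t) \<ge> R"
      using sol sol' t
      by (auto simp: is_solution_def AC_curves_def configurations_def norm_minus_commute less_imp_le)
    have B0: "0 \<le> B" using der[OF t] by (meson norm_ge_zero order_trans)
    have "norm (?v' - ?v) = norm (mobility a (y' t - x' t) *v u t - mobility a (y t - x t) *v u t)"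
      by (simp add: norm_Pair)
    also have "\<dots> \<le> (3 * \<bar>a\<bar> / 4) * (6 / R\<^sup>2 * norm (u t) * ?\<delta>)"
      by (rule mobility_lipschitz[OF R conf(2,1)])
    also have "\<dots> \<le> (3 * \<bar>a\<bar> / 4) * (6 / R\<^sup>2 * B * ?\<delta>)"
      using der[OF t] by (intro mult_left_mono mult_right_mono) auto
    also have "\<dots> = K * ?\<delta>" by (simp add: K_def)
    also have "\<dots> \<le> K * (2 * norm ((x' t, y' t) - (x t, y t)))"
    proof (rule mult_left_mono)
      have "?\<delta> \<le> norm (y' t - y t) + norm (x' t - x t)"
        using norm_triangle_ineq4[of "y' t - y t" "x' t - x t"] by (simp add: algebra_simps)
      also have "\<dots> \<le> 2 * norm ((x' t, y' t) - (x t, y t))"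
        using norm_fst_le[of "x' t - x t" "y' t - y t"] norm_snd_le[of "y' t - y t" "x' t - x t"]
        by simp
      finally show "?\<delta> \<le> 2 * norm ((x' t, y' t) - (x t, y t))" .
    qed (use B0 in \<open>simp add: K_def\<close>)
    finally have "norm (?v' - ?v) \<le> 2 * K * norm ((x' t, y' t) - (x t, y t))" by simp
    then show "\<exists>v v'. ((\<lambda>t. (x' t, y' t)) has_vector_derivative v) (at t within {0..T}) \<and>
        ((\<lambda>t. (x t, y t)) has_vector_derivative v') (at t within {0..T}) \<and>
        norm (v - v') \<le> 2 * K * norm ((x' t, y' t) - (x t, y t))"
      using der[OF t] by (blast intro: has_vector_derivative_Pair)
  qed (use N t in auto)
  then show ?thesis by simp
qed

section \<open>Concatenation of steering arcs\<close>

text \<open>Piecewise smooth steering: regularity is stronger than a solution requires (Lipschitz instead of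
  absolutely continuous, a finite instead of a null exceptional set), which makes concatenation of
  arcs elementary.\<close>

definition steers :: "real \<Rightarrow> real \<Rightarrow> (real^3) \<times> (real^3) \<Rightarrow> (real^3) \<times> (real^3) \<Rightarrow> bool" where
  "steers a R p q \<longleftrightarrow> (\<exists>T>0. \<exists>u z F L B.
     u \<in> borel_measurable borel \<and> (\<forall>t\<in>{0..T}. norm (u t) \<le> B) \<and>
     L-lipschitz_on {0..T} z \<and> z ` {0..T} \<subseteq> configurations R \<and> z 0 = p \<and> z T = q \<and>
     finite F \<and> (\<forall>t\<in>{0..T} - F.
       (z has_vector_derivative (u t, mobility a (snd (z t) - fst (z t)) *v u t)) (at t)))"

lemma steers_trans [trans]:
  assumes "steers a R p q" "steers a R q s"
  shows "steers a R p s"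
proof -
  obtain T1 u1 z1 F1 L1 B1 where 1: "T1 > 0" "u1 \<in> borel_measurable borel"
    "\<And>t. t \<in> {0..T1} \<Longrightarrow> norm (u1 t) \<le> B1" "L1-lipschitz_on {0..T1} z1"
    "z1 ` {0..T1} \<subseteq> configurations R" "z1 0 = p" "z1 T1 = q" "finite F1"
    "\<And>t. t \<in> {0..T1} - F1 \<Longrightarrow>
       (z1 has_vector_derivative (u1 t, mobility a (snd (z1 t) - fst (z1 t)) *v u1 t)) (at t)"
    using assms(1) unfolding steers_def by blast
  obtain T2 u2 z2 F2 L2 B2 where 2: "T2 > 0" "u2 \<in> borel_measurable borel"
    "\<And>t. t \<in> {0..T2} \<Longrightarrow> norm (u2 t) \<le> B2" "L2-lipschitz_on {0..T2} z2"
    "z2 ` {0..T2} \<subseteq> configurations R" "z2 0 = q" "z2 T2 = s" "finite F2"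
    "\<And>t. t \<in> {0..T2} - F2 \<Longrightarrow>
       (z2 has_vector_derivative (u2 t, mobility a (snd (z2 t) - fst (z2 t)) *v u2 t)) (at t)"
    using assms(2) unfolding steers_def by blast
  define z where "z t = (if t \<le> T1 then z1 t else z2 (t - T1))" for t
  define u where "u t = (if t \<le> T1 then u1 t else u2 (t - T1))" for t
  define F where "F = F1 \<union> (\<lambda>t. t + T1) ` F2 \<union> {T1}"
  have "L2-lipschitz_on {T1..T1 + T2} (\<lambda>t. z2 (t - T1))"
  proof (rule lipschitz_onI)
    show "dist (z2 (s - T1)) (z2 (t - T1)) \<le> L2 * dist s t"
      if "s \<in> {T1..T1 + T2}" "t \<in> {T1..T1 + T2}" for s t
      using lipschitz_onD[OF 2(4), of "s - T1" "t - T1"] that by (simp add: dist_real_def)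
  qed (rule lipschitz_on_nonneg[OF 2(4)])
  then have lip: "(max L1 L2)-lipschitz_on {0..T1 + T2} z"
    unfolding z_def using lipschitz_on_concat_max[OF 1(4), of L2 "T1 + T2"] 1(7) 2(6) by simp
  have der: "(z has_vector_derivative (u t, mobility a (snd (z t) - fst (z t)) *v u t)) (at t)"
    if t: "t \<in> {0..T1 + T2} - F" for t
  proof (cases "t < T1")
    case True
    then have "(z1 has_vector_derivative (u t, mobility a (snd (z t) - fst (z t)) *v u t)) (at t)"
      using 1(9)[of t] t by (auto simp: F_def z_def u_def)
    then show ?thesis
      by (rule has_vector_derivative_transform_within_open[where S = "{..<T1}"])
        (use True in \<open>auto simp: z_def\<close>)
  next
    case False
    then have gt: "t > T1" using t by (auto simp: F_def)
    have "t - T1 \<notin> F2" using t by (force simp: F_def image_iff)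
    then have "(z2 has_vector_derivative (u t, mobility a (snd (z t) - fst (z t)) *v u t))
        (at (t - T1))"
      using 2(9)[of "t - T1"] t gt by (auto simp: z_def u_def)
    moreover have "((\<lambda>t. t - T1) has_vector_derivative 1) (at t)"
      by (auto intro!: derivative_eq_intros)
    ultimately have "((z2 \<circ> (\<lambda>t. t - T1)) has_vector_derivative
        1 *\<^sub>R (u t, mobility a (snd (z t) - fst (z t)) *v u t)) (at t)"
      by (intro vector_diff_chain_at) auto
    then have "((\<lambda>t. z2 (t - T1)) has_vector_derivative
        (u t, mobility a (snd (z t) - fst (z t)) *v u t)) (at t)"
      by (simp add: o_def)
    then show ?thesis
      by (rule has_vector_derivative_transform_within_open[where S = "{T1<..}"])
        (use gt in \<open>auto simp: z_def\<close>)
  qed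
  have meas: "u \<in> borel_measurable borel"
    unfolding u_def using 1(2) 2(2) by measurable
  have bound: "norm (u t) \<le> max B1 B2" if "t \<in> {0..T1 + T2}" for t
    using 1(3)[of t] 2(3)[of "t - T1"] that by (auto simp: u_def)
  have conf: "z ` {0..T1 + T2} \<subseteq> configurations R"
    using 1(5) 2(5) by (auto simp: z_def image_subset_iff)
  have "finite F" using 1(8) 2(8) by (simp add: F_def)
  moreover have "T1 + T2 > 0" "z 0 = p" "z (T1 + T2) = s"
    using 1(1,6) 2(1,7) by (auto simp: z_def)
  ultimately show ?thesis
    unfolding steers_def using meas bound lip conf der by blast
qed

lemma steers_imp_solution:
  assumes "steers a R p q" "R > 0"
  shows "\<exists>T>0. \<exists>u \<in> L_infinity {0..T}. \<exists>x y. is_solution a R T u p x y \<and>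
           (\<forall>x' y'. is_solution a R T u p x' y' \<longrightarrow> (\<forall>t\<in>{0..T}. x' t = x t \<and> y' t = y t)) \<and>
           (x T, y T) = q"
proof -
  obtain T u z F L B where 1: "T > 0" "u \<in> borel_measurable borel"
    "\<And>t. t \<in> {0..T} \<Longrightarrow> norm (u t) \<le> B" "L-lipschitz_on {0..T} z"
    "z ` {0..T} \<subseteq> configurations R" "z 0 = p" "z T = q" "finite F"
    and der: "\<And>t. t \<in> {0..T} - F \<Longrightarrow>
       (z has_vector_derivative (u t, mobility a (snd (z t) - fst (z t)) *v u t)) (at t)"
    using assms(1) unfolding steers_def by blast
  define x y where "x = (\<lambda>t. fst (z t))" and "y = (\<lambda>t. snd (z t))"
  have "u \<in> borel_measurable (lebesgue_on {0..T})"
    using 1(2) by (intro measurable_restrict_space1 measurable_completion) simp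
  then have u: "u \<in> L_infinity {0..T}"
    using 1(3) by (auto simp: L_infinity_def intro!: exI[of _ B])
  have comp: "(x has_vector_derivative u t) (at t within {0..T}) \<and>
      (y has_vector_derivative mobility a (y t - x t) *v u t) (at t within {0..T})"
    if t: "t \<in> {0..T} - F" for t
  proof -
    have "(z has_derivative (\<lambda>h. h *\<^sub>R (u t, mobility a (y t - x t) *v u t))) (at t within {0..T})"
      using der[OF t]
      by (auto simp: x_def y_def has_vector_derivative_def intro: has_derivative_at_withinI)
    from has_derivative_fst[OF this] has_derivative_snd[OF this] show ?thesis
      by (simp add: x_def y_def has_vector_derivative_def)
  qed
  have "AE t in lebesgue_on {0..T}.
      (x has_vector_derivative u t) (at t within {0..T}) \<and>
      (y has_vector_derivative mobility a (y t - x t) *v u t) (at t within {0..T})"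
  proof (rule AE_I')
    show "F \<inter> {0..T} \<in> null_sets (lebesgue_on {0..T})"
      using \<open>finite F\<close> negligible_finite[of "F \<inter> {0..T}"]
      by (simp add: null_sets_restrict_space negligible_iff_null_sets)
  qed (use comp in auto)
  then have sol: "is_solution a R T u p x y"
    using 1 lipschitz_imp_absolutely_continuous_on[OF 1(4)]
    by (auto simp: is_solution_def AC_curves_def x_def y_def)
  moreover have "(x T, y T) = q" using 1 by (simp add: x_def y_def)
  ultimately show ?thesis
    using 1(1) u is_solution_unique[OF assms(2) u sol] by blast
qed

text \<open>The state is described by the passive position \<open>y\<close> and the displacement \<open>d\<close>, so that the control
  \<open>y' - d'\<close> is determined by the curve, and the system reduces to one relation between \<open>y'\<close> and \<open>d'\<close>.\<close>

lemma steers_smooth_arc: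
  fixes d y d' y' :: "real \<Rightarrow> real^3"
  assumes "T > 0"
    and d: "\<And>t. t \<in> {0..T} \<Longrightarrow> (d has_vector_derivative d' t) (at t)"
    and y: "\<And>t. t \<in> {0..T} \<Longrightarrow> (y has_vector_derivative y' t) (at t)"
    and cont: "continuous_on {0..T} d'" "continuous_on {0..T} y'"
    and meas: "d' \<in> borel_measurable borel" "y' \<in> borel_measurable borel"
    and sep: "\<And>t. t \<in> {0..T} \<Longrightarrow> norm (d t) > R"
    and eq: "\<And>t. t \<in> {0..T} \<Longrightarrow> y' t = mobility a (d t) *v (y' t - d' t)"
  shows "steers a R (y 0 - d 0, y 0) (y T - d T, y T)"
proof -
  define z where "z t = (y t - d t, y t)" for t
  define u where "u t = y' t - d' t" for t
  have der: "(z has_vector_derivative (u t, mobility a (snd (z t) - fst (z t)) *v u t)) (at t)"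
    if "t \<in> {0..T}" for t
    using has_vector_derivative_Pair[OF has_vector_derivative_diff[OF y d] y] that eq[OF that]
    unfolding z_def u_def by simp
  have "bounded ((\<lambda>t. (u t, y' t)) ` {0..T})"
    unfolding u_def using cont
    by (intro compact_imp_bounded compact_continuous_image continuous_intros) auto
  then obtain B where B: "\<And>t. t \<in> {0..T} \<Longrightarrow> norm (u t, y' t) \<le> B"
    unfolding bounded_iff by (meson imageI)
  have Bu: "norm (u t) \<le> B" if "t \<in> {0..T}" for t
    using B[OF that] norm_fst_le[of "u t" "y' t"] by simp
  have B0: "B \<ge> 0" using Bu[of 0] \<open>T > 0\<close> by (auto intro: order_trans[OF norm_ge_zero])
  have lip: "B-lipschitz_on {0..T} z"
  proof (rule bounded_derivative_imp_lipschitz)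
    fix t assume t: "t \<in> {0..T}"
    have eq': "(u t, mobility a (snd (z t) - fst (z t)) *v u t) = (u t, y' t)"
      using eq[OF t] by (simp add: z_def u_def)
    show "(z has_derivative (\<lambda>h. h *\<^sub>R (u t, y' t))) (at t within {0..T})"
      using der[OF t] unfolding eq' has_vector_derivative_def by (rule has_derivative_at_withinI)
    show "onorm (\<lambda>h. h *\<^sub>R (u t, y' t)) \<le> B"
    proof (rule onorm_bound[OF B0])
      fix h :: real
      have "norm (h *\<^sub>R (u t, y' t)) = \<bar>h\<bar> * norm (u t, y' t)" by (rule norm_scaleR)
      also have "\<dots> \<le> \<bar>h\<bar> * B" using B[OF t] by (rule mult_left_mono) simp
      finally show "norm (h *\<^sub>R (u t, y' t)) \<le> B * norm h" by (simp add: mult.commute)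
    qed
  qed (use B0 in auto)
  have "u \<in> borel_measurable borel" unfolding u_def using meas by measurable
  moreover have "z ` {0..T} \<subseteq> configurations R"
    using sep by (auto simp: z_def configurations_def)
  ultimately show ?thesis
    unfolding steers_def using \<open>T > 0\<close> Bu lip der
    by (intro exI[of _ T] conjI exI[of _ u] exI[of _ z] exI[of _ "{}"] exI[of _ B])
      (auto simp: z_def)
qed

section \<open>Rotations and radial motions\<close>

text \<open>The angle is taken strictly positive, by a full extra turn, so that it can serve as a duration
  even when the two vectors coincide.\<close>

lemma unit_vectors_rotation:
  fixes e f :: "'a::euclidean_space"
  assumes "2 \<le> DIM('a)" and e: "norm e = 1" and f: "norm f = 1"
  obtains g \<theta> where "norm g = 1" "e \<bullet> g = 0" "\<theta> > 0" "f = cos \<theta> *\<^sub>R e + sin \<theta> *\<^sub>R g"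
proof -
  define c where "c = e \<bullet> f"
  define w where "w = f - c *\<^sub>R e"
  have ee: "e \<bullet> e = 1" "f \<bullet> f = 1" using e f by (simp_all add: dot_square_norm)
  have ew: "e \<bullet> w = 0" by (simp add: w_def c_def inner_diff_right ee)
  obtain g s where g: "norm g = 1" "e \<bullet> g = 0" "w = s *\<^sub>R g"
  proof (cases "w = 0")
    case True
    obtain v where v: "v \<noteq> 0" "orthogonal e v"
      using orthogonal_to_vector_exists[OF assms(1)] by blast
    then show ?thesis
      using that[of "v /\<^sub>R norm v" 0] True by (simp add: orthogonal_def)
  next
    case False
    then show ?thesis using that[of "w /\<^sub>R norm w" "norm w"] ew by simp
  qed
  have gg: "g \<bullet> g = 1" using g(1) by (simp add: dot_square_norm)
  have fe: "f = c *\<^sub>R e + s *\<^sub>R g" using g(3) by (simp add: w_def algebra_simps)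
  have "f \<bullet> f = c\<^sup>2 + s\<^sup>2"
    unfolding fe using g(2) ee gg
    by (simp add: inner_add_left inner_add_right inner_commute power2_eq_square)
  then have "c\<^sup>2 + s\<^sup>2 = 1" using ee by simp
  then obtain t where t: "0 \<le> t" "c = cos t" "s = sin t" using sincos_total_2pi by metis
  show ?thesis
  proof (rule that[OF g(1,2)])
    show "t + 2 * pi > 0" using t(1) pi_gt_zero by linarith
    show "f = cos (t + 2 * pi) *\<^sub>R e + sin (t + 2 * pi) *\<^sub>R g" using fe t by simp
  qed
qed

text \<open>Moving \<open>d\<close> along a great circle of radius \<open>r\<close> keeps \<open>d'\<close> orthogonal to \<open>d\<close>. With
  \<open>m = 3a / (4r)\<close> the equation reads \<open>y' = m (y' - d')\<close>, hence \<open>y' = - \<beta> d'\<close> with the constant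
  \<open>\<beta> = m / (1 - m) = 3a / (4r - 3a)\<close>, and \<open>y + \<beta> d\<close> is conserved.\<close>

lemma steers_rotation:
  fixes e f y :: "real^3"
  assumes a: "a > 0" "R > 2 * a" "r > R" and e: "norm e = 1" and f: "norm f = 1"
    and y': "y' = y - (3 * a / (4 * r - 3 * a)) *\<^sub>R (r *\<^sub>R f - r *\<^sub>R e)"
  shows "steers a R (y - r *\<^sub>R e, y) (y' - r *\<^sub>R f, y')"
proof -
  obtain g \<theta> where g: "norm g = 1" "e \<bullet> g = 0" "\<theta> > 0" "f = cos \<theta> *\<^sub>R e + sin \<theta> *\<^sub>R g"
    using unit_vectors_rotation[OF _ e f] by auto
  define \<beta> where "\<beta> = 3 * a / (4 * r - 3 * a)"
  define d where "d t = r *\<^sub>R (cos t *\<^sub>R e + sin t *\<^sub>R g)" for t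
  define d' where "d' t = r *\<^sub>R (- sin t *\<^sub>R e + cos t *\<^sub>R g)" for t
  have r: "r > 0" "4 * r - 3 * a > 0" using a by linarith+
  have eg: "e \<bullet> e = 1" "g \<bullet> g = 1" using e g by (simp_all add: dot_square_norm)
  have ds: "d t \<bullet> d t = r\<^sup>2" for t
  proof -
    have "d t \<bullet> d t = r\<^sup>2 * (cos t)\<^sup>2 + r\<^sup>2 * (sin t)\<^sup>2"
      by (simp add: d_def inner_add_left inner_add_right inner_commute g(2) eg power2_eq_square
          algebra_simps)
    also have "\<dots> = r\<^sup>2 * ((cos t)\<^sup>2 + (sin t)\<^sup>2)" by (simp only: distrib_left)
    finally show ?thesis by simp
  qed
  have nd: "norm (d t) = r" for t
    using ds[of t] r by (simp add: norm_eq_sqrt_inner)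
  have dd': "d t \<bullet> d' t = 0" for t
    by (simp add: d_def d'_def inner_add_left inner_add_right inner_diff_right inner_commute g(2) eg)
  have dd: "(d has_vector_derivative d' t) (at t)" for t
    unfolding d_def d'_def has_vector_derivative_def
    by (rule derivative_eq_intros refl)+ (auto simp: algebra_simps)
  have "steers a R ((y - \<beta> *\<^sub>R (d 0 - r *\<^sub>R e)) - d 0, y - \<beta> *\<^sub>R (d 0 - r *\<^sub>R e))
      ((y - \<beta> *\<^sub>R (d \<theta> - r *\<^sub>R e)) - d \<theta>, y - \<beta> *\<^sub>R (d \<theta> - r *\<^sub>R e))"
  proof (rule steers_smooth_arc[OF g(3), where d = d and d' = d'
        and y = "\<lambda>t. y - \<beta> *\<^sub>R (d t - r *\<^sub>R e)" and y' = "\<lambda>t. - \<beta> *\<^sub>R d' t"])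
    show "(d has_vector_derivative d' t) (at t)" for t by (rule dd)
    have "((\<lambda>t. y - \<beta> *\<^sub>R (d t - r *\<^sub>R e)) has_vector_derivative 0 - \<beta> *\<^sub>R (d' t - 0)) (at t)" for t
      by (intro has_vector_derivative_diff has_vector_derivative_const
          bounded_linear.has_vector_derivative[OF bounded_linear_scaleR_right] dd)
    then show "((\<lambda>t. y - \<beta> *\<^sub>R (d t - r *\<^sub>R e)) has_vector_derivative - \<beta> *\<^sub>R d' t) (at t)" for t
      by simp
    have cont: "continuous_on A d'" for A unfolding d'_def by (intro continuous_intros)
    show "continuous_on {0..\<theta>} d'" by (rule cont)
    show "continuous_on {0..\<theta>} (\<lambda>t. - \<beta> *\<^sub>R d' t)" by (intro continuous_intros cont)
    show "d' \<in> borel_measurable borel" "(\<lambda>t. - \<beta> *\<^sub>R d' t) \<in> borel_measurable borel"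
      by (rule borel_measurable_continuous_onI, intro continuous_intros cont)+
    show "norm (d t) > R" for t using nd a by simp
    show "- \<beta> *\<^sub>R d' t = mobility a (d t) *v (- \<beta> *\<^sub>R d' t - d' t)" for t
    proof -
      have "- \<beta> *\<^sub>R d' t - d' t = (- (1 + \<beta>)) *\<^sub>R d' t" by (simp add: algebra_simps)
      then have "mobility a (d t) *v (- \<beta> *\<^sub>R d' t - d' t) = 
          (3 * a / (4 * r)) *\<^sub>R ((- (1 + \<beta>)) *\<^sub>R d' t)"
        using mobility_orthogonal[of "d t" "(- (1 + \<beta>)) *\<^sub>R d' t" a] dd' nd by simp
      also have "\<dots> = (- (3 * a / (4 * r) * (1 + \<beta>))) *\<^sub>R d' t"
        by (simp only: scaleR_scaleR mult_minus_right)
      also have "3 * a / (4 * r) * (1 + \<beta>) = \<beta>"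
        using r by (simp add: \<beta>_def field_simps)
      finally show ?thesis by simp
    qed
  qed
  moreover have "d 0 = r *\<^sub>R e" "d \<theta> = r *\<^sub>R f" by (simp_all add: d_def g(4))
  ultimately show ?thesis using y' by (simp add: \<beta>_def)
qed

text \<open>An antiderivative of \<open>m / (1 - m) = 3a / (2r - 3a)\<close> for the radial eigenvalue \<open>m = 3a / (2r)\<close>:
  under radial motion in direction \<open>e\<close>, the vector \<open>y + radial_drag a r *\<^sub>R e\<close> is conserved.\<close>

definition radial_drag :: "real \<Rightarrow> real \<Rightarrow> real" where
  "radial_drag a r = 3 * a / 2 * ln (2 * r - 3 * a)"

lemma steers_radial:
  fixes e y :: "real^3"
  assumes a: "a > 0" "R > 2 * a" "r > R" "s > R" and e: "norm e = 1"
    and y': "y' = y - (radial_drag a s - radial_drag a r) *\<^sub>R e"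
  shows "steers a R (y - r *\<^sub>R e, y) (y' - s *\<^sub>R e, y')"
proof -
  define \<rho> where "\<rho> t = r + t * (s - r)" for t
  define \<alpha> where "\<alpha> t = 3 * a / (2 * \<rho> t - 3 * a)" for t
  have \<rho>: "\<rho> t > R" if "t \<in> {0..1}" for t
  proof -
    have "\<rho> t = (1 - t) * r + t * s" by (simp add: \<rho>_def algebra_simps)
    also have "\<dots> > (1 - t) * R + t * R"
    proof (cases "t = 0")
      case False
      then show ?thesis using that a
        by (intro add_le_less_mono mult_left_mono mult_strict_left_mono) auto
    qed (use a in auto)
    finally show ?thesis by (simp add: algebra_simps)
  qed
  have pos: "2 * \<rho> t - 3 * a > 0" "\<rho> t > 0" if "t \<in> {0..1}" for t
    using \<rho>[OF that] a by linarith+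
  let ?y = "\<lambda>t. y - (radial_drag a (\<rho> t) - radial_drag a r) *\<^sub>R e"
  have "steers a R (?y 0 - \<rho> 0 *\<^sub>R e, ?y 0) (?y 1 - \<rho> 1 *\<^sub>R e, ?y 1)"
  proof (rule steers_smooth_arc[where d = "\<lambda>t. \<rho> t *\<^sub>R e" and y = ?y and d' = "\<lambda>t. (s - r) *\<^sub>R e"
        and y' = "\<lambda>t. (- (\<alpha> t * (s - r))) *\<^sub>R e"])
    show "((\<lambda>t. \<rho> t *\<^sub>R e) has_vector_derivative (s - r) *\<^sub>R e) (at t)" for t
      unfolding \<rho>_def has_vector_derivative_def
      by (rule derivative_eq_intros refl)+ (auto simp: algebra_simps)
    show "(?y has_vector_derivative (- (\<alpha> t * (s - r))) *\<^sub>R e) (at t)" if t: "t \<in> {0..1}" for t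
    proof -
      have "((\<lambda>t. radial_drag a (\<rho> t)) has_real_derivative \<alpha> t * (s - r)) (at t)"
      proof -
        have "(\<rho> has_real_derivative s - r) (at t)"
          unfolding \<rho>_def by (auto intro!: derivative_eq_intros)
        then have "((\<lambda>t. 2 * \<rho> t - 3 * a) has_real_derivative 2 * (s - r)) (at t)"
          by (auto intro!: derivative_eq_intros)
        from DERIV_chain2[where f = ln, OF DERIV_ln_divide[OF pos(1)[OF t]] this]
        have "((\<lambda>t. ln (2 * \<rho> t - 3 * a)) has_real_derivative
            1 / (2 * \<rho> t - 3 * a) * (2 * (s - r))) (at t)"
          .
        then have "((\<lambda>t. radial_drag a (\<rho> t)) has_real_derivative
            3 * a / 2 * (1 / (2 * \<rho> t - 3 * a) * (2 * (s - r)))) (at t)"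
          unfolding radial_drag_def by (rule DERIV_cmult)
        moreover have "3 * a / 2 * (1 / (2 * \<rho> t - 3 * a) * (2 * (s - r))) = \<alpha> t * (s - r)"
          using pos(1)[OF t] by (simp add: \<alpha>_def divide_simps) (simp add: algebra_simps)
        ultimately show ?thesis by (simp only:)
      qed
      then have "((\<lambda>t. radial_drag a (\<rho> t) - radial_drag a r) has_vector_derivative \<alpha> t * (s - r)) (at t)"
        by (auto intro!: derivative_eq_intros simp: has_real_derivative_iff_has_vector_derivative)
      then have "(?y has_vector_derivative 0 - (\<alpha> t * (s - r)) *\<^sub>R e) (at t)"
        by (intro has_vector_derivative_diff has_vector_derivative_const
            bounded_linear.has_vector_derivative[OF bounded_linear_scaleR_left])
      then show ?thesis by simp
    qed
    show "continuous_on {0..1} (\<lambda>t. (s - r) *\<^sub>R e)" by simp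
    have "2 * \<rho> t - 3 * a \<noteq> 0" if "t \<in> {0..1}" for t using pos[OF that] by linarith
    then show "continuous_on {0..1} (\<lambda>t. (- (\<alpha> t * (s - r))) *\<^sub>R e)"
      unfolding \<alpha>_def \<rho>_def by (intro continuous_intros) auto
    show "(\<lambda>t. (s - r) *\<^sub>R e) \<in> borel_measurable borel" by simp
    show "(\<lambda>t. (- (\<alpha> t * (s - r))) *\<^sub>R e) \<in> borel_measurable borel"
      unfolding \<alpha>_def \<rho>_def by measurable
    show "norm (\<rho> t *\<^sub>R e) > R" if "t \<in> {0..1}" for t
      using \<rho>[OF that] pos[OF that] e by simp
    show "(- (\<alpha> t * (s - r))) *\<^sub>R e = mobility a (\<rho> t *\<^sub>R e) *v
        ((- (\<alpha> t * (s - r))) *\<^sub>R e - (s - r) *\<^sub>R e)" if t: "t \<in> {0..1}" for t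
    proof -
      let ?c = "- ((\<alpha> t + 1) * (s - r))"
      have "(- (\<alpha> t * (s - r))) *\<^sub>R e - (s - r) *\<^sub>R e = ?c *\<^sub>R e" by (simp add: algebra_simps)
      then have "mobility a (\<rho> t *\<^sub>R e) *v ((- (\<alpha> t * (s - r))) *\<^sub>R e - (s - r) *\<^sub>R e) = 
          (3 * a * ?c / (2 * \<rho> t)) *\<^sub>R e"
        by (simp only: mobility_parallel[OF e pos(2)[OF t]])
      also have "3 * a * ?c / (2 * \<rho> t) = - ((3 * a * (\<alpha> t + 1) / (2 * \<rho> t)) * (s - r))"
        by (simp add: mult_ac)
      also have "3 * a * (\<alpha> t + 1) / (2 * \<rho> t) = \<alpha> t"
        using pos[OF t] by (simp add: \<alpha>_def field_simps)
      finally show ?thesis by simp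
    qed
  qed simp
  then show ?thesis using y' by (simp add: \<rho>_def)
qed

section \<open>Controllability\<close>

text \<open>Turning from some direction to \<open>n\<close> at distance \<open>r\<close>, moving out to \<open>t\<close>, turning to \<open>- n\<close>, moving to \<open>s\<close>
  and turning away from \<open>- n\<close> displaces \<open>y\<close> by a multiple of \<open>n\<close>, up to a vector that does not depend
  on \<open>n\<close> and \<open>t\<close>. The left-hand side is this multiple as a function of \<open>t\<close>. Its values at \<open>r\<close> and
  \<open>s\<close> are negatives of each other, and it tends to minus infinity because \<open>t * \<beta> t\<close> is bounded while
  the radial drag grows logarithmically; so it attains every nonpositive value.\<close>

lemma radial_turning_distance:
  fixes a R r s m :: real
  assumes a: "a > 0" "R > 2 * a" "r > R" "s > R" and m: "m \<ge> 0"
  defines "\<beta> \<equiv> \<lambda>t. 3 * a / (4 * t - 3 * a)"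
  obtains t where "t > R"
    "2 * (t * \<beta> t - radial_drag a t) - (r * \<beta> r - radial_drag a r)
       - (s * \<beta> s - radial_drag a s) = - m"
proof -
  define h where "h t = t * \<beta> t - radial_drag a t" for t
  define g where "g t = 2 * h t - h r - h s" for t
  \<comment> \<open>\<open>g r = h r - h s = - g s\<close>, so \<open>g\<close> is nonnegative at one of the two distances.\<close>
  obtain t0 where t0: "t0 > R" "g t0 \<ge> 0"
  proof (cases "h r \<ge> h s")
    case True then show ?thesis using that[of r] a by (simp add: g_def)
  next
    case False then show ?thesis using that[of s] a by (simp add: g_def)
  qed
  define K where "K = 6 * a - h r - h s + m"
  \<comment> \<open>\<open>t * \<beta> t \<le> 3 a\<close>, so it is enough that twice the radial drag at \<open>t1\<close> reaches \<open>K\<close>.\<close>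
  define L where "L = K / (3 * a)"
  define t1 where "t1 = max t0 ((exp L + 3 * a) / 2)"
  have "t1 \<ge> (exp L + 3 * a) / 2" "t1 \<ge> t0"
    unfolding t1_def by (rule max.cobounded2, rule max.cobounded1)
  then have t1: "t1 \<ge> t0" "2 * t1 - 3 * a \<ge> exp L" by (simp_all add: field_simps)
  have "g t1 \<le> - m"
  proof -
    have "t1 * \<beta> t1 \<le> 3 * a"
      using t1(1) t0 a by (simp add: \<beta>_def field_simps)
    moreover have "L \<le> ln (2 * t1 - 3 * a)"
      using t1(2) by (metis exp_gt_zero ln_exp ln_le_cancel_iff order_less_le_trans)
    then have "K \<le> 2 * radial_drag a t1"
      using a by (simp add: radial_drag_def L_def field_simps)
    moreover have "g t1 = 2 * (t1 * \<beta> t1) - 2 * radial_drag a t1 - h r - h s"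
      by (simp add: g_def h_def)
    ultimately show ?thesis unfolding K_def by linarith
  qed
  moreover have "continuous_on {t0..t1} g"
    unfolding g_def h_def \<beta>_def radial_drag_def using t0 a
    by (intro continuous_intros) auto
  ultimately obtain t where "t0 \<le> t" "t \<le> t1" "g t = - m"
    using IVT2'[of g t1 "- m" t0] t0(2) t1(1) m by auto
  then show ?thesis using that[of t] t0(1) unfolding g_def h_def by simp
qed

text \<open>In the direction of the displacement \<open>d\<close>, the route is: turn to \<open>n\<close> at distance \<open>r\<close>, move out to
  distance \<open>t\<close>, turn to \<open>- n\<close>, move to distance \<open>s\<close>, turn to the final direction. The net change of
  \<open>y\<close> is a fixed vector plus a multiple of \<open>n\<close>; the direction \<open>n\<close> is chosen along the remaining error
  \<open>v\<close> and the distance \<open>t\<close> so that the multiple has the length of \<open>v\<close>.\<close>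

lemma configurations_steers:
  fixes x0 y0 xf yf :: "real^3"
  assumes a: "a > 0" "R > 2 * a"
    and p: "(x0, y0) \<in> configurations R" and q: "(xf, yf) \<in> configurations R"
  shows "steers a R (x0, y0) (xf, yf)"
proof -
  define r s where "r = norm (y0 - x0)" and "s = norm (yf - xf)"
  have rs: "r > R" "s > R"
    using p q by (simp_all add: configurations_def r_def s_def norm_minus_commute)
  then have rs0: "r > 0" "s > 0" using a by linarith+
  define e f where "e = (y0 - x0) /\<^sub>R r" and "f = (yf - xf) /\<^sub>R s"
  have ef: "norm e = 1" "norm f = 1" using rs0 by (simp_all add: e_def f_def r_def s_def)
  have d: "x0 = y0 - r *\<^sub>R e" "xf = yf - s *\<^sub>R f" using rs0 by (simp_all add: e_def f_def)
  define \<beta> where "\<beta> t = 3 * a / (4 * t - 3 * a)" for t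
  define F where "F = radial_drag a"
  define v where "v = (yf + (s * \<beta> s) *\<^sub>R f) - (y0 + (r * \<beta> r) *\<^sub>R e)"
  obtain t where t: "t > R" 
    "2 * (t * \<beta> t - F t) - (r * \<beta> r - F r) - (s * \<beta> s - F s) = - norm v"
    using radial_turning_distance[OF a rs norm_ge_zero[of v]] unfolding \<beta>_def F_def by blast
  obtain n where n: "norm n = 1" "v = (- norm v) *\<^sub>R n"
  proof (cases "v = 0")
    case True
    then show ?thesis using that[of e] ef by simp
  next
    case False
    then show ?thesis using that[of "- v /\<^sub>R norm v"] by simp
  qed
  define y1 where "y1 = y0 - \<beta> r *\<^sub>R (r *\<^sub>R n - r *\<^sub>R e)"
  define y2 where "y2 = y1 - (F t - F r) *\<^sub>R n"
  define y3 where "y3 = y2 - \<beta> t *\<^sub>R (t *\<^sub>R (- n) - t *\<^sub>R n)"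
  define y4 where "y4 = y3 - (F s - F t) *\<^sub>R (- n)"
  have "yf = y4 - \<beta> s *\<^sub>R (s *\<^sub>R f - s *\<^sub>R (- n))"
  proof -
    have "y4 - \<beta> s *\<^sub>R (s *\<^sub>R f - s *\<^sub>R (- n)) = y0 + (r * \<beta> r) *\<^sub>R e - (s * \<beta> s) *\<^sub>R f +
        (2 * (t * \<beta> t - F t) - (r * \<beta> r - F r) - (s * \<beta> s - F s)) *\<^sub>R n"
      unfolding y4_def y3_def y2_def y1_def by (simp add: vec_eq_iff algebra_simps)
    also have "\<dots> = y0 + (r * \<beta> r) *\<^sub>R e - (s * \<beta> s) *\<^sub>R f + v"
      unfolding t(2) using n(2) by simp
    also have "\<dots> = yf" by (simp add: v_def)
    finally show ?thesis by simp
  qed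
  note n' = n(1) norm_minus_cancel[of n, unfolded n(1)]
  have "steers a R (y0 - r *\<^sub>R e, y0) (y1 - r *\<^sub>R n, y1)"
    using a rs ef n' by (intro steers_rotation) (auto simp: y1_def \<beta>_def)
  also have "steers a R \<dots> (y2 - t *\<^sub>R n, y2)"
    using a rs t n' by (intro steers_radial) (auto simp: y2_def F_def)
  also have "steers a R \<dots> (y3 - t *\<^sub>R (- n), y3)"
    using a t n' by (intro steers_rotation) (auto simp: y3_def \<beta>_def)
  also have "steers a R \<dots> (y4 - s *\<^sub>R (- n), y4)"
    using a rs t n' by (intro steers_radial) (auto simp: y4_def F_def)
  also have "steers a R \<dots> (yf - s *\<^sub>R f, yf)"
    using a rs ef n' \<open>yf = _\<close> by (intro steers_rotation) (auto simp: \<beta>_def)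
  finally show ?thesis unfolding d[symmetric] .
qed

theorem theorem4p1:
  shows "\<exists>C::real. C \<ge> 2 \<and>
    (\<forall>a R :: real. a > 0 \<and> R > C * a \<longrightarrow>
      (\<forall>x0 y0 xf yf :: real^3.
        (x0, y0) \<in> configurations R \<and> (xf, yf) \<in> configurations R \<longrightarrow>
        (\<exists>T>0. \<exists>u \<in> L_infinity {0..T}. \<exists>x y.
           is_solution a R T u (x0, y0) x y \<and>
           (\<forall>x' y'. is_solution a R T u (x0, y0) x' y' \<longrightarrow>
              (\<forall>t\<in>{0..T}. x' t = x t \<and> y' t = y t)) \<and>
           (x T, y T) = (xf, yf))))"
proof (rule exI[of _ "2::real"], intro conjI allI impI)
  fix a R :: real and x0 y0 xf yf :: "real^3"
  assume aR: "0 < a \<and> 2 * a < R"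
    and pq: "(x0, y0) \<in> configurations R \<and> (xf, yf) \<in> configurations R"
  have "steers a R (x0, y0) (xf, yf)"
    using configurations_steers aR pq by blast
  moreover have "R > 0" using aR by linarith
  ultimately show "\<exists>T>0. \<exists>u \<in> L_infinity {0..T}. \<exists>x y.
           is_solution a R T u (x0, y0) x y \<and>
           (\<forall>x' y'. is_solution a R T u (x0, y0) x' y' \<longrightarrow>
              (\<forall>t\<in>{0..T}. x' t = x t \<and> y' t = y t)) \<and>
           (x T, y T) = (xf, yf)"
    by (rule steers_imp_solution)
qed simp

end
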